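(* Let $H$ be a Hilbert space, let $A(t)$, $t\ge0$, be bounded linear operators in $H$, and let $F:[0,\infty)\times H\to H$ be a nonlinear map. Assume that there are constants $k>0$, $c_0>0$, $p>1$ such that $$\mathrm{Re}(A(t)u,u)\le-k\|u\|^2,\qquad \|F(t,u)\|\le c_0\|u\|^p\qquad\forall t\ge0,\ \forall u\in H.$$ Consider the Cauchy problem $\dot u=A(t)u+F(t,u)$, $u(0)=u_0$, under the standing solvability assumption given in the context. Then for every $\epsilon\in(0,k)$ there is a $\delta>0$ such that, if $\|u_0\|\le\delta$, the solution $u(t)$ exists for all $t\ge0$ and satisfies $$\|u(t)\|=O\left(e^{-(k-\epsilon)t}\right)\qquad\text{as }t\to\infty.$$
   Context: Here $\dot u=du/dt$. Standing solvability assumption: for each $u_0\in H$ the Cauchy problem has a continuously differentiable solution $u:[0,T)\to H$ on a maximal interval of existence $[0,T)$, $0<T\le\infty$, and if $T<\infty$ then $\lim_{t\to T-0}\|u(t)\|=\infty$. (This holds, for example, if the right-hand side is continuous in $t$ and locally Lipschitz in $u$.) *)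

theory Defs
  imports "HOL-Analysis.Analysis" "HOL-Library.Landau_Symbols"
begin

text \<open>
  Complex Hilbert spaces. The inner product is linear in its first argument. Positivity and
  definiteness of the inner product follow from the last axiom, completeness from \<^class>\<open>banach\<close>.
\<close>

class complex_hilbert = banach +
  fixes scaleC :: "complex \<Rightarrow> 'a \<Rightarrow> 'a"
    and cinner :: "'a \<Rightarrow> 'a \<Rightarrow> complex"
  assumes scaleC_add_right: "scaleC c (x + y) = scaleC c x + scaleC c y"
    and scaleC_add_left: "scaleC (c + d) x = scaleC c x + scaleC d x"
    and scaleC_scaleC: "scaleC c (scaleC d x) = scaleC (c * d) x"
    and scaleC_of_real: "scaleC (complex_of_real r) x = r *\<^sub>R x"
    and cinner_commute: "cinner x y = cnj (cinner y x)"
    and cinner_add_left: "cinner (x + y) z = cinner x z + cinner y z"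
    and cinner_scaleC_left: "cinner (scaleC c x) y = c * cinner x y"
    and cinner_self: "cinner x x = complex_of_real ((norm x)\<^sup>2)"

instantiation complex :: complex_hilbert
begin

definition scaleC_complex :: "complex \<Rightarrow> complex \<Rightarrow> complex"
  where "scaleC_complex c x = c * x"

definition cinner_complex :: "complex \<Rightarrow> complex \<Rightarrow> complex"
  where "cinner_complex x y = x * cnj y"

instance
proof
  fix c d x y z :: complex and r :: real
  show "scaleC c (x + y) = scaleC c x + scaleC c y"
    by (simp add: scaleC_complex_def distrib_left)
  show "scaleC (c + d) x = scaleC c x + scaleC d x"
    by (simp add: scaleC_complex_def distrib_right)
  show "scaleC c (scaleC d x) = scaleC (c * d) x"
    by (simp add: scaleC_complex_def)
  show "scaleC (complex_of_real r) x = r *\<^sub>R x"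
    by (simp only: scaleC_complex_def scaleR_conv_of_real)
  show "cinner x y = cnj (cinner y x)"
    by (simp add: cinner_complex_def)
  show "cinner (x + y) z = cinner x z + cinner y z"
    by (simp add: cinner_complex_def distrib_right)
  show "cinner (scaleC c x) y = c * cinner x y"
    by (simp add: cinner_complex_def scaleC_complex_def)
  show "cinner x x = complex_of_real ((norm x)\<^sup>2)"
    by (simp only: cinner_complex_def complex_norm_square)
qed

end

definition bounded_clinear :: "('a::complex_hilbert \<Rightarrow> 'a) \<Rightarrow> bool"
  where "bounded_clinear f \<longleftrightarrow>
    bounded_linear f \<and> (\<forall>c x. f (scaleC c x) = scaleC c (f x))"

definition ex_interval :: "ereal \<Rightarrow> real set"
  where "ex_interval T = {t. 0 \<le> t \<and> ereal t < T}"

text \<open>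
  \<open>u\<close> is a continuously differentiable solution of \<open>u' = A(t) u + F(t, u)\<close>, \<open>u(0) = u0\<close> on \<open>[0, T)\<close>,
  where \<open>0 < T \<le> \<infinity>\<close>. The derivative at \<open>0\<close> is one-sided; values of \<open>u\<close> outside \<open>[0, T)\<close> are
  irrelevant.
\<close>

definition cauchy_solution ::
  "(real \<Rightarrow> 'a \<Rightarrow> 'a::complex_hilbert) \<Rightarrow> (real \<Rightarrow> 'a \<Rightarrow> 'a) \<Rightarrow> 'a \<Rightarrow> ereal \<Rightarrow> (real \<Rightarrow> 'a) \<Rightarrow> bool"
  where "cauchy_solution A F u0 T u \<longleftrightarrow>
    0 < T \<and> u 0 = u0 \<and>
    (\<exists>u'. continuous_on (ex_interval T) u' \<and>
      (\<forall>t \<in> ex_interval T.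
        (u has_vector_derivative u' t) (at t within ex_interval T) \<and>
        u' t = A t (u t) + F t (u t)))"

text \<open>No solution on a longer interval extends \<open>u\<close>.\<close>

definition maximal_solution ::
  "(real \<Rightarrow> 'a \<Rightarrow> 'a::complex_hilbert) \<Rightarrow> (real \<Rightarrow> 'a \<Rightarrow> 'a) \<Rightarrow> 'a \<Rightarrow> ereal \<Rightarrow> (real \<Rightarrow> 'a) \<Rightarrow> bool"
  where "maximal_solution A F u0 T u \<longleftrightarrow>
    cauchy_solution A F u0 T u \<and>
    (\<nexists>T' v. T < T' \<and> cauchy_solution A F u0 T' v \<and> (\<forall>t \<in> ex_interval T. v t = u t))"

text \<open>
  A maximal solution whose norm blows up at the end of its interval of existence if that end is
  finite. Blow-up is a separate requirement: neither continuity nor local Lipschitz continuity of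
  the right-hand side is assumed, so it need not follow from maximality.
\<close>

definition blowup_solution ::
  "(real \<Rightarrow> 'a \<Rightarrow> 'a::complex_hilbert) \<Rightarrow> (real \<Rightarrow> 'a \<Rightarrow> 'a) \<Rightarrow> 'a \<Rightarrow> ereal \<Rightarrow> (real \<Rightarrow> 'a) \<Rightarrow> bool"
  where "blowup_solution A F u0 T u \<longleftrightarrow>
    maximal_solution A F u0 T u \<and>
    (T < \<infinity> \<longrightarrow> filterlim (\<lambda>t. norm (u t)) at_top (at_left (real_of_ereal T)))"

definition solvable ::
  "(real \<Rightarrow> 'a \<Rightarrow> 'a::complex_hilbert) \<Rightarrow> (real \<Rightarrow> 'a \<Rightarrow> 'a) \<Rightarrow> bool"
  where "solvable A F \<longleftrightarrow> (\<forall>u0. \<exists>T u. blowup_solution A F u0 T u)"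

end

theory Submission imports Defs
begin

text \<open>
  Let \<open>\<rho>\<close> be the radius with \<open>c0 \<rho> powr (p - 1) = \<epsilon>\<close>. As long as \<open>\<parallel>u\<parallel> \<le> \<rho>\<close>, the dissipation absorbs
  the nonlinearity: \<open>(\<parallel>u\<parallel>\<^sup>2)' \<le> - 2 (k - \<epsilon>) \<parallel>u\<parallel>\<^sup>2\<close>, so \<open>exp (2 (k - \<epsilon>) t) \<parallel>u\<parallel>\<^sup>2\<close> does not increase.
  A solution starting in the ball of radius \<open>\<rho> / 2\<close> therefore cannot reach the sphere of radius
  \<open>\<rho>\<close>, since it would be in the smaller ball at the first time of contact. Hence it does
  not blow up in finite time, and the bound holds for all times.
\<close>

text \<open>Time derivatives are real and dissipativity bounds a real part, so the estimates take
  place in the underlying real inner product space, which carries the same norm.\<close>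

definition rinner :: "'a::complex_hilbert \<Rightarrow> 'a \<Rightarrow> real"
  where "rinner x y = Re (cinner x y)"

lemma rinner_commute: "rinner x y = rinner y x"
  unfolding rinner_def by (subst cinner_commute) simp

lemma rinner_add_left: "rinner (x + y) z = rinner x z + rinner y z"
  by (simp add: rinner_def cinner_add_left)

lemma rinner_scaleR_left: "rinner (r *\<^sub>R x) y = r * rinner x y"
  by (simp add: rinner_def cinner_scaleC_left flip: scaleC_of_real)

lemma rinner_self: "rinner x x = (norm x)\<^sup>2"
  by (simp add: rinner_def cinner_self)

lemma norm_add_square: "(norm (x + y))\<^sup>2 = (norm x)\<^sup>2 + 2 * rinner x y + (norm y)\<^sup>2"
  for x y :: "'a::complex_hilbert"
proof -
  have "rinner (x + y) (x + y) = rinner x (x + y) + rinner y (x + y)"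
    by (rule rinner_add_left)
  also have "\<dots> = rinner (x + y) x + rinner (x + y) y"
    by (simp add: rinner_commute)
  finally show ?thesis
    by (simp add: rinner_add_left rinner_commute[of y x] flip: rinner_self)
qed

text \<open>One-sided Cauchy-Schwarz: the triangle inequality is already a norm axiom, and squaring
  and expanding it leaves exactly this bound on the cross term.\<close>

lemma rinner_le_norm: "rinner x y \<le> norm x * norm y"
proof -
  have "(norm (x + y))\<^sup>2 \<le> (norm x + norm y)\<^sup>2"
    by (intro power_mono norm_triangle_ineq norm_ge_zero)
  then show ?thesis
    by (simp add: norm_add_square power2_sum)
qed

lemma bounded_bilinear_rinner: "bounded_bilinear rinner"
proof
  fix a a' b b' :: 'a and r :: real
  show "rinner (a + a') b = rinner a b + rinner a' b"
    by (rule rinner_add_left)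
  show "rinner a (b + b') = rinner a b + rinner a b'"
    by (metis rinner_add_left rinner_commute)
  show "rinner (r *\<^sub>R a) b = r *\<^sub>R rinner a b"
    by (simp add: rinner_scaleR_left)
  show "rinner a (r *\<^sub>R b) = r *\<^sub>R rinner a b"
    by (metis real_scaleR_def rinner_commute rinner_scaleR_left)
  \<comment> \<open>Applying the one-sided bound to \<open>- x\<close> as well controls the absolute
    value.\<close>
  have "\<bar>rinner x y\<bar> \<le> norm x * norm y" for x y :: 'a
    using rinner_le_norm[of x y] rinner_le_norm[of "-1 *\<^sub>R x" y]
    unfolding rinner_scaleR_left by simp
  then show "\<exists>K. \<forall>x y :: 'a. norm (rinner x y) \<le> norm x * norm y * K"
    by (intro exI[of _ 1]) simp
qed

text \<open>This is the product rule for a bilinear form. The square is used because the norm itself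
  need not be differentiable where \<open>u\<close> vanishes.\<close>

lemma has_real_derivative_norm_square:
  fixes u :: "real \<Rightarrow> 'a::complex_hilbert"
  assumes "(u has_vector_derivative u') (at t within S)"
  shows "((\<lambda>t. (norm (u t))\<^sup>2) has_real_derivative 2 * rinner u' (u t)) (at t within S)"
proof -
  have "((\<lambda>t. rinner (u t) (u t)) has_vector_derivative rinner (u t) u' + rinner u' (u t))
      (at t within S)"
    by (rule bounded_bilinear.has_vector_derivative[OF bounded_bilinear_rinner assms assms])
  then show ?thesis
    by (simp add: rinner_self rinner_commute[of "u t"] has_real_derivative_iff_has_vector_derivative)
qed

text \<open>By Cauchy-Schwarz \<open>f\<close> contributes at most
  \<open>c * norm x powr (p + 1)\<close>. Bounding the factor \<open>norm x powr (p - 1)\<close> by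
  its value at \<rho> leaves a quadratic term, which is set against the dissipation.\<close>

lemma dissipative_rinner_bound:
  fixes x a f :: "'a::complex_hilbert"
  assumes "rinner a x \<le> - k * (norm x)\<^sup>2"
    and "norm f \<le> c * norm x powr p"
    and "c \<ge> 0" "p > 1" "norm x \<le> \<rho>"
  shows "rinner (a + f) x \<le> - (k - c * \<rho> powr (p - 1)) * (norm x)\<^sup>2"
proof -
  \<comment> \<open>This includes \<open>x = 0\<close>, where both sides vanish since
    \<open>0 powr p = 0\<close>.\<close>
  have powr: "norm x powr p = norm x * norm x powr (p - 1)"
    by (simp add: powr_mult_base)
  have "rinner f x \<le> norm f * norm x"
    by (rule rinner_le_norm)
  also have "\<dots> \<le> c * norm x powr p * norm x"
    using assms by (simp add: mult_right_mono)
  also have "\<dots> = c * norm x powr (p - 1) * (norm x)\<^sup>2"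
    by (simp add: powr power2_eq_square)
  also have "\<dots> \<le> c * \<rho> powr (p - 1) * (norm x)\<^sup>2"
    using assms by (intro mult_right_mono mult_left_mono powr_mono2) auto
  finally show ?thesis
    using assms(1) by (simp add: rinner_add_left algebra_simps)
qed

text \<open>Gronwall's inequality in differential form: the integrating factor
  \<open>exp (c * t)\<close> makes the product nonincreasing. Derivatives are taken in the open
  interval only, which avoids the one-sided derivative at 0.\<close>

lemma exp_decay_of_derivative_bound:
  fixes g g' :: "real \<Rightarrow> real"
  assumes "0 \<le> s" and cont: "continuous_on {0..s} g"
    and deriv: "\<And>t. 0 < t \<Longrightarrow> t < s \<Longrightarrow> (g has_real_derivative g' t) (at t)"
    and bound: "\<And>t. 0 < t \<Longrightarrow> t < s \<Longrightarrow> g' t \<le> - c * g t"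
  shows "g s \<le> exp (- c * s) * g 0"
proof -
  have "exp (c * s) * g s \<le> exp (c * 0) * g 0"
  proof (rule DERIV_nonpos_imp_decreasing_open[where f = "\<lambda>t. exp (c * t) * g t", OF assms(1)])
    show "continuous_on {0..s} (\<lambda>t. exp (c * t) * g t)"
      by (intro continuous_intros cont)
    fix t assume t: "0 < t" "t < s"
    have "((\<lambda>t. exp (c * t) * g t) has_real_derivative exp (c * t) * (c * g t + g' t)) (at t)"
      by (auto intro!: derivative_eq_intros deriv t simp: algebra_simps)
    moreover have "exp (c * t) * (c * g t + g' t) \<le> 0"
      using bound[OF t] by (simp add: mult_nonneg_nonpos)
    ultimately show "\<exists>y. ((\<lambda>t. exp (c * t) * g t) has_real_derivative y) (at t) \<and> y \<le> 0"
      by blast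
  qed
  then show ?thesis
    by (simp add: exp_minus field_simps)
qed

text \<open>The times in \<open>{0..s}\<close> with \<open>r \<le> f t\<close> form a compact set
  containing \<open>s\<close>; its least element is the first contact.\<close>

lemma continuous_first_contact:
  fixes f :: "real \<Rightarrow> real"
  assumes "0 \<le> s" "continuous_on {0..s} f" "r \<le> f s"
  obtains t where "0 \<le> t" "t \<le> s" "r \<le> f t" "\<And>\<tau>. 0 \<le> \<tau> \<Longrightarrow> \<tau> < t \<Longrightarrow> f \<tau> < r"
proof -
  let ?S = "{0..s} \<inter> f -` {r..}"
  have "closed ?S"
    using assms(2) by (intro continuous_closed_preimage) auto
  then have "compact ?S"
    using bounded_subset[OF bounded_closed_interval, of ?S 0 s] by (simp add: compact_eq_bounded_closed)
  then obtain t where t: "t \<in> ?S" "\<forall>\<tau>\<in>?S. t \<le> \<tau>"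
    using compact_attains_inf[of ?S] assms by (metis (no_types, lifting) IntI atLeastAtMost_iff
        atLeast_iff empty_iff order_refl vimageI)
  show thesis
  proof
    fix \<tau> assume "0 \<le> \<tau>" "\<tau> < t"
    then show "f \<tau> < r"
      using t by force
  qed (use t in auto)
qed

lemma cauchy_solution_decay:
  fixes u :: "real \<Rightarrow> 'a::complex_hilbert"
  assumes sol: "cauchy_solution A F u0 T u"
    and A: "\<And>t u. t \<ge> 0 \<Longrightarrow> Re (cinner (A t u) u) \<le> - k * (norm u)\<^sup>2"
    and F: "\<And>t u. t \<ge> 0 \<Longrightarrow> norm (F t u) \<le> c * norm u powr p"
    and "c \<ge> 0" "p > 1"
    and gap: "c * \<rho> powr (p - 1) \<le> k"
    and u0: "norm u0 < \<rho>"
    and s: "s \<in> ex_interval T"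
  shows "norm (u s) \<le> exp (- (k - c * \<rho> powr (p - 1)) * s) * norm u0"
proof -
  define m where "m = k - c * \<rho> powr (p - 1)"
  have "m \<ge> 0" using gap by (simp add: m_def)
  from sol obtain u' where "u 0 = u0"
    and der: "\<And>t. t \<in> ex_interval T \<Longrightarrow> (u has_vector_derivative u' t) (at t within ex_interval T)"
    and u': "\<And>t. t \<in> ex_interval T \<Longrightarrow> u' t = A t (u t) + F t (u t)"
    unfolding cauchy_solution_def by blast
  have sub: "{0..s} \<subseteq> ex_interval T" if "s \<in> ex_interval T" for s
  proof
    fix t assume "t \<in> {0..s}"
    then show "t \<in> ex_interval T"
      using that by (auto simp: ex_interval_def intro: le_less_trans[of "ereal t" "ereal s"])
  qed
  have cont: "continuous_on {0..s} u" if "s \<in> ex_interval T" for s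
    using has_vector_derivative_continuous[OF der] continuous_on_subset[OF _ sub[OF that]]
    by (auto simp: continuous_on_eq_continuous_within)
  \<comment> \<open>Smallness is required strictly before \<open>s\<close> but not at
    \<open>s\<close>, so this also applies at a first time of contact with the sphere of radius
    \<rho>.\<close>
  have decay: "norm (u s) \<le> exp (- m * s) * norm u0"
    if s: "s \<in> ex_interval T" and small: "\<And>t. 0 \<le> t \<Longrightarrow> t < s \<Longrightarrow> norm (u t) < \<rho>" for s
  proof -
    have "(norm (u s))\<^sup>2 \<le> exp (- (2 * m) * s) * (norm (u 0))\<^sup>2"
    proof (rule exp_decay_of_derivative_bound)
      show "0 \<le> s" using s by (simp add: ex_interval_def)
      show "continuous_on {0..s} (\<lambda>t. (norm (u t))\<^sup>2)"
        by (intro continuous_intros cont s)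
      fix t assume t: "0 < t" "t < s"
      then have tT: "t \<in> ex_interval T" using sub[OF s] by auto
      \<comment> \<open>Passing to an open neighbourhood of \<open>t\<close> turns the derivative
        within \<open>ex_interval T\<close> into an ordinary one.\<close>
      have "(u has_vector_derivative u' t) (at t within {0<..<s})"
        using sub[OF s] by (intro has_vector_derivative_within_subset[OF der[OF tT]]) auto
      then have "(u has_vector_derivative u' t) (at t)"
        using t by (simp add: at_within_open[of t "{0<..<s}"])
      then show "((\<lambda>t. (norm (u t))\<^sup>2) has_real_derivative 2 * rinner (u' t) (u t)) (at t)"
        by (rule has_real_derivative_norm_square)
      have "rinner (u' t) (u t) \<le> - m * (norm (u t))\<^sup>2"
        unfolding u'[OF tT] m_def
      proof (rule dissipative_rinner_bound)
        show "rinner (A t (u t)) (u t) \<le> - k * (norm (u t))\<^sup>2"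
          using A[of t "u t"] t by (simp add: rinner_def)
      qed (use F[of t "u t"] small[of t] t \<open>c \<ge> 0\<close> \<open>p > 1\<close> in auto)
      then show "2 * rinner (u' t) (u t) \<le> - (2 * m) * (norm (u t))\<^sup>2"
        by simp
    qed
    also have "\<dots> = (exp (- m * s) * norm u0)\<^sup>2"
      by (simp add: \<open>u 0 = u0\<close> power_mult_distrib flip: exp_double)
    finally show ?thesis
      by (rule power2_le_imp_le) simp
  qed
  have small: "norm (u t) < \<rho>" if t: "t \<in> ex_interval T" for t
  proof (rule ccontr)
    assume "\<not> norm (u t) < \<rho>"
    then have "\<rho> \<le> norm (u t)" by simp
    moreover have "0 \<le> t" using t by (simp add: ex_interval_def)
    moreover have "continuous_on {0..t} (\<lambda>t. norm (u t))"
      by (intro continuous_intros cont t)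
    ultimately obtain t1 where t1: "0 \<le> t1" "t1 \<le> t" "\<rho> \<le> norm (u t1)"
        "\<And>\<tau>. 0 \<le> \<tau> \<Longrightarrow> \<tau> < t1 \<Longrightarrow> norm (u \<tau>) < \<rho>"
      using continuous_first_contact[of t "\<lambda>t. norm (u t)" \<rho>] by blast
    have "norm (u t1) \<le> exp (- m * t1) * norm u0"
      using t1 sub[OF t] by (intro decay) auto
    \<comment> \<open>The rate \<open>m\<close> is nonnegative by \<open>gap\<close>, so the norm at
      contact is at most \<open>norm u0\<close>, which is less than \<rho>.\<close>
    also have "\<dots> \<le> 1 * norm u0"
      using \<open>m \<ge> 0\<close> t1(1) by (intro mult_right_mono) auto
    finally show False
      using t1(3) u0 by simp
  qed
  have "norm (u s) \<le> exp (- m * s) * norm u0"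
  proof (rule decay[OF s])
    fix t assume "0 \<le> t" "t < s"
    then show "norm (u t) < \<rho>"
      using sub[OF s] by (intro small) auto
  qed
  then show ?thesis by (simp add: m_def)
qed

lemma blowup_solution_bounded_global:
  assumes "blowup_solution A F u0 T u"
    and bound: "\<And>t. t \<in> ex_interval T \<Longrightarrow> norm (u t) \<le> B"
  shows "T = \<infinity>"
proof (rule ccontr)
  assume "T \<noteq> \<infinity>"
  moreover have "0 < T"
    using assms(1) by (simp add: blowup_solution_def maximal_solution_def cauchy_solution_def)
  ultimately obtain r where r: "T = ereal r" "0 < r"
    by (cases T) auto
  then have "filterlim (\<lambda>t. norm (u t)) at_top (at_left r)"
    using assms(1) by (simp add: blowup_solution_def)
  then have "eventually (\<lambda>t. B < norm (u t)) (at_left r)"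
    by (simp add: filterlim_at_top_dense)
  moreover have "eventually (\<lambda>t. t \<in> {0<..<r}) (at_left r)"
    using r(2) by (rule eventually_at_left_real)
  \<comment> \<open>Blow-up pushes the norm above \<open>B\<close> at times just before
    \<open>r\<close>, which still lie in \<open>ex_interval T\<close>; the filter
    \<open>at_left r\<close> is nontrivial.\<close>
  ultimately have "eventually (\<lambda>t. False) (at_left r)"
  proof eventually_elim
    case (elim t)
    then show ?case
      using bound[of t] by (simp add: ex_interval_def r(1))
  qed
  then show False by simp
qed

theorem theorem3:
  fixes A :: "real \<Rightarrow> 'a \<Rightarrow> 'a::complex_hilbert"
    and F :: "real \<Rightarrow> 'a \<Rightarrow> 'a"
    and k c0 p :: real
  assumes "k > 0" and "c0 > 0" and "p > 1"
    and "\<And>t. t \<ge> 0 \<Longrightarrow> bounded_clinear (A t)"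
    and "\<And>t u. t \<ge> 0 \<Longrightarrow> Re (cinner (A t u) u) \<le> - k * (norm u)\<^sup>2"
    and "\<And>t u. t \<ge> 0 \<Longrightarrow> norm (F t u) \<le> c0 * norm u powr p"
    and "solvable A F"
  shows "\<forall>\<epsilon>\<in>{0<..<k}. \<exists>\<delta>>0. \<forall>u0. norm u0 \<le> \<delta> \<longrightarrow>
    (\<exists>u. blowup_solution A F u0 \<infinity> u) \<and>
    (\<forall>T u. blowup_solution A F u0 T u \<longrightarrow>
      T = \<infinity> \<and> (\<lambda>t. norm (u t)) \<in> O(\<lambda>t. exp (- (k - \<epsilon>) * t)))"
proof
  fix \<epsilon> assume \<epsilon>: "\<epsilon> \<in> {0<..<k}"
  define \<rho> where "\<rho> = (\<epsilon> / c0) powr (1 / (p - 1))"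
  have "\<rho> > 0" using \<epsilon> assms(2) by (simp add: \<rho>_def)
  have \<rho>: "c0 * \<rho> powr (p - 1) = \<epsilon>"
    using \<epsilon> assms(2,3) by (simp add: \<rho>_def powr_powr)
  have main: "T = \<infinity> \<and> (\<lambda>t. norm (u t)) \<in> O(\<lambda>t. exp (- (k - \<epsilon>) * t))"
    if u0: "norm u0 \<le> \<rho> / 2" and u: "blowup_solution A F u0 T u" for u0 T u
  proof -
    have decay: "norm (u t) \<le> exp (- (k - \<epsilon>) * t) * norm u0" if "t \<in> ex_interval T" for t
      using cauchy_solution_decay[of A F u0 T u k c0 p \<rho> t] assms u u0 that \<rho> \<epsilon> \<open>\<rho> > 0\<close>
      by (simp add: blowup_solution_def maximal_solution_def)
    \<comment> \<open>\<open>T\<close> may still be finite here, so the decay is first weakened to a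
      constant bound, which rules out blow-up.\<close>
    have "norm (u t) \<le> norm u0" if t: "t \<in> ex_interval T" for t
    proof -
      have "exp (- (k - \<epsilon>) * t) * norm u0 \<le> 1 * norm u0"
        using \<epsilon> t by (intro mult_right_mono) (auto simp: ex_interval_def mult_le_0_iff)
      then show ?thesis using decay[OF t] by simp
    qed
    then have T: "T = \<infinity>"
      by (rule blowup_solution_bounded_global[OF u])
    have "eventually (\<lambda>t. norm (norm (u t)) \<le> norm u0 * norm (exp (- (k - \<epsilon>) * t))) at_top"
      using eventually_ge_at_top[of 0]
    proof eventually_elim
      case (elim t)
      then show ?case
        using decay[of t] by (simp add: ex_interval_def T mult.commute)
    qed
    then show ?thesis
      using T by (blast intro: bigoI)
  qed
  show "\<exists>\<delta>>0. \<forall>u0. norm u0 \<le> \<delta> \<longrightarrow>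
    (\<exists>u. blowup_solution A F u0 \<infinity> u) \<and>
    (\<forall>T u. blowup_solution A F u0 T u \<longrightarrow>
      T = \<infinity> \<and> (\<lambda>t. norm (u t)) \<in> O(\<lambda>t. exp (- (k - \<epsilon>) * t)))"
  \<comment> \<open>Halving \<rho> turns \<open>norm u0 \<le> \<delta>\<close> into the strict
    inequality \<open>norm u0 < \<rho>\<close> required by
    \<open>cauchy_solution_decay\<close>.\<close>
  proof (intro exI[of _ "\<rho> / 2"] conjI allI impI)
    show "\<rho> / 2 > 0" using \<open>\<rho> > 0\<close> by simp
    fix u0 :: 'a assume u0: "norm u0 \<le> \<rho> / 2"
    \<comment> \<open>Solvability provides a solution with an unspecified \<open>T\<close>;
      \<open>main\<close> then forces \<open>T = \<infinity>\<close>.\<close>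
    obtain T u where "blowup_solution A F u0 T u"
      using assms(7) unfolding solvable_def by blast
    then show "\<exists>u. blowup_solution A F u0 \<infinity> u"
      using main[OF u0] by blast
  qed (use main in blast)+
qed

end
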